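(* Let $n\geq 2$ be an integer. Then for every integer $k > (n-1)^2+1$, $$a^a_n(k) = 3a^a_n(k-1)-3a^a_n(k-2) + a^a_n(k-3).$$
   Context: For integers $n\geq 1$ and $k\geq 0$, the $n$ by $k$ grid is the set of points $\{1,\dots,n\}\times\{1,\dots,k\}\subset\mathbb{R}^2$ (empty if $k=0$, so that $a^a_n(0)=0$). $a^a_n(k)$ denotes the number of acute isosceles triangles of nonzero area formed by 3 distinct points of the $n$ by $k$ grid, i.e. the number of 3-element non-collinear subsets of the grid that are the vertices of a triangle with at least two sides of equal Euclidean length and with all angles strictly less than $90^\circ$. *)

theory Defs
  imports "HOL-Analysis.Analysis"
begin

definition grid :: "nat \<Rightarrow> nat \<Rightarrow> (real \<times> real) set" where
  "grid n k = (\<lambda>(i, j). (real i, real j)) ` ({1..n} \<times> {1..k})"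

(* vangle a b c is the unoriented angle abc, with vertex b, in radians.
   It is only meaningful when b differs from both a and c. *)
definition vangle :: "'a::real_inner \<Rightarrow> 'a \<Rightarrow> 'a \<Rightarrow> real" where
  "vangle a b c = arccos (((a - b) \<bullet> (c - b)) / (norm (a - b) * norm (c - b)))"

(* A triangle is represented by its set of vertices. *)
definition is_triangle :: "'a::real_inner set \<Rightarrow> bool" where
  "is_triangle T \<longleftrightarrow> card T = 3 \<and> \<not> collinear T"

definition isosceles :: "'a::real_inner set \<Rightarrow> bool" where
  "isosceles T \<longleftrightarrow> (\<exists>a b c. T = {a, b, c} \<and> distinct [a, b, c] \<and> dist a b = dist a c)"

definition acute :: "'a::real_inner set \<Rightarrow> bool" where
  "acute T \<longleftrightarrow> (\<forall>a\<in>T. \<forall>b\<in>T. \<forall>c\<in>T. distinct [a, b, c] \<longrightarrow> vangle a b c < pi / 2)"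

definition acute_isosceles_count :: "nat \<Rightarrow> nat \<Rightarrow> nat" where
  "acute_isosceles_count n k =
     card {T. T \<subseteq> grid n k \<and> is_triangle T \<and> isosceles T \<and> acute T}"

end

theory Submission
  imports Defs
begin

text \<open>
  Fix the number \<open>n\<close> of columns and write \<open>a k\<close> for the number of acute isosceles triangles in
  \<open>k\<close> rows. A triangle in rows \<open>1..k\<close> that does not touch both extreme rows lies in rows
  \<open>1..k-1\<close> or in rows \<open>2..k\<close>, and it lies in both ranges iff it lies in rows \<open>2..k-1\<close>. As
  the property is invariant under vertical translation, inclusion-exclusion gives
  \<open>a k - 2 * a (k-1) + a (k-2) = f k\<close>, where \<open>f k\<close> counts the triangles that touch both
  extreme rows (\<open>acute_isosceles_count_second_difference\<close>). The recurrence to be shown says that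
  the third difference of \<open>a\<close> vanishes, that is, \<open>f k = f (k-1)\<close>.

  So it suffices that \<open>f (h+1)\<close> is constant for \<open>h \<ge> (n-1)\<^sup>2\<close>.
  If a triangle has vertices in the bottom and in the top row and its third vertex lies strictly
  between them, the angle at this third vertex spans a height of \<open>h\<close> within
  horizontal distance \<open>n - 1\<close> on either side; for such \<open>h\<close> it is too
  large, apart from a borderline shape at \<open>h = (n-1)\<^sup>2\<close> with an acute angle
  there, which fails to be isosceles (\<open>no_vertex_strictly_between\<close>). Hence two
  vertices share an extreme row. As the base angles are acute, the side joining them is shorter
  than the other two, so the remaining vertex lies over its midpoint
  (\<open>apex_is_centred\<close>). Conversely every such triangle is acute, because the apex is
  farther from the base than half the base length. The resulting family does not depend on
  \<open>h\<close> up to vertical stretching (\<open>spanning_triangles_tall\<close>).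
\<close>

section \<open>Acute isosceles triangles in coordinates\<close>

definition acute_isosceles :: "(real \<times> real) set \<Rightarrow> bool" where
  "acute_isosceles T \<longleftrightarrow> is_triangle T \<and> isosceles T \<and> acute T"

lemma vangle_less_pi_half_iff:
  fixes a b c :: "'a::real_inner"
  assumes "a \<noteq> b" "c \<noteq> b"
  shows "vangle a b c < pi / 2 \<longleftrightarrow> 0 < (a - b) \<bullet> (c - b)"
proof -
  let ?x = "((a - b) \<bullet> (c - b)) / (norm (a - b) * norm (c - b))"
  have pos: "0 < norm (a - b) * norm (c - b)"
    using assms by simp
  have "\<bar>?x\<bar> \<le> 1"
    using pos Cauchy_Schwarz_ineq2[of "a - b" "c - b"] by (simp add: divide_le_eq)
  then have "arccos ?x < arccos 0 \<longleftrightarrow> 0 < ?x"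
    by (intro arccos_less_mono) auto
  also have "0 < ?x \<longleftrightarrow> 0 < (a - b) \<bullet> (c - b)"
    using pos by (simp add: zero_less_divide_iff)
  finally show ?thesis
    by (simp add: vangle_def)
qed

lemma between_imp_inner_le_0:
  fixes a b c :: "'a::euclidean_space"
  assumes "between (a, b) c"
  shows "(a - c) \<bullet> (b - c) \<le> 0"
proof -
  obtain u where u: "0 \<le> u" "u \<le> 1" and c: "c = (1 - u) *\<^sub>R a + u *\<^sub>R b"
    using assms by (auto simp: between_mem_segment in_segment)
  have "a - c = (- u) *\<^sub>R (b - a)" "b - c = (1 - u) *\<^sub>R (b - a)"
    by (simp_all add: c algebra_simps)
  then have "(a - c) \<bullet> (b - c) = - (u * (1 - u) * ((b - a) \<bullet> (b - a)))"
    by (simp only: inner_scaleR_left inner_scaleR_right)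
       (simp add: algebra_simps)
  then show ?thesis
    using u by simp
qed

text \<open>
  Three positive inner products already force the vertices to be distinct (two equal
  vertices give the inner product zero) and not collinear (the middle one would see the other
  two at a straight angle). Nondegeneracy is thus encoded in the angle condition, and the
  criterion holds for arbitrary triples.
\<close>
lemma acute_isosceles_iff:
  "acute_isosceles {p, q, r} \<longleftrightarrow>
     0 < (q - p) \<bullet> (r - p) \<and> 0 < (p - q) \<bullet> (r - q) \<and> 0 < (p - r) \<bullet> (q - r) \<and>
     (dist p q = dist p r \<or> dist q p = dist q r \<or> dist r p = dist r q)"
  (is "?L \<longleftrightarrow> ?D \<and> ?E \<and> ?F \<and> ?I")
proof (cases "distinct [p, q, r]")
  case False
  then have "card {p, q, r} \<noteq> 3"
    by (auto simp: card_insert_if)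
  then show ?thesis
    using False by (auto simp: acute_isosceles_def is_triangle_def)
next
  case True
  have acute: "acute {p, q, r} \<longleftrightarrow> ?D \<and> ?E \<and> ?F"
  proof -
    have "vangle a b c = vangle c b a" for a b c :: "real \<times> real"
      by (simp add: vangle_def inner_commute mult.commute)
    then have "acute {p, q, r} \<longleftrightarrow>
        vangle q p r < pi / 2 \<and> vangle p q r < pi / 2 \<and> vangle p r q < pi / 2"
      using True unfolding acute_def by auto
    then show ?thesis
      using True vangle_less_pi_half_iff[of q p r] vangle_less_pi_half_iff[of p q r]
        vangle_less_pi_half_iff[of p r q] by force
  qed
  have iso: "isosceles {p, q, r} \<longleftrightarrow> ?I"
  proof
    assume "isosceles {p, q, r}"
    then obtain a b c where T: "{p, q, r} = {a, b, c}" and d: "distinct [a, b, c]"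
      and e: "dist a b = dist a c"
      by (auto simp: isosceles_def)
    have "a \<in> {p, q, r}" "b \<in> {p, q, r}" "c \<in> {p, q, r}"
      unfolding T by auto
    then show ?I
      using d e True by auto
  next
    assume ?I
    moreover have "{p, q, r} = {q, p, r}" "{p, q, r} = {r, p, q}"
      by auto
    ultimately show "isosceles {p, q, r}"
      using True unfolding isosceles_def
      by (metis distinct_length_2_or_more distinct_singleton)
  qed
  have "\<not> collinear {p, q, r}" if "?D" "?E" "?F"
    using that between_imp_inner_le_0[of p q r] between_imp_inner_le_0[of q r p]
      between_imp_inner_le_0[of r p q]
    by (auto simp: collinear_between_cases inner_commute)
  then have "is_triangle {p, q, r}" if "?D" "?E" "?F"
    using that True by (simp add: is_triangle_def)
  then show ?thesis
    unfolding acute_isosceles_def acute iso by blast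
qed

lemma acute_isosceles_card: "acute_isosceles T \<Longrightarrow> card T = 3"
  by (simp add: acute_isosceles_def is_triangle_def)

text \<open>
  Integer rather than natural coordinates, so that differences of coordinates do not truncate.
\<close>
definition lattice_point :: "int \<Rightarrow> int \<Rightarrow> real \<times> real" where
  "lattice_point x y = (of_int x, of_int y)"

lemma lattice_point_eq_iff [simp]:
  "lattice_point x y = lattice_point x' y' \<longleftrightarrow> x = x' \<and> y = y'"
  by (simp add: lattice_point_def)

lemma inner_lattice_point:
  "(lattice_point a b - lattice_point x y) \<bullet> (lattice_point c d - lattice_point x y) =
     of_int ((a - x) * (c - x) + (b - y) * (d - y))"
  by (simp add: lattice_point_def)

lemma dist_lattice_point:
  "dist (lattice_point x y) (lattice_point a b) = sqrt (of_int ((x - a)\<^sup>2 + (y - b)\<^sup>2))"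
  by (simp add: lattice_point_def dist_Pair_Pair dist_real_def)

lemma acute_isosceles_lattice_iff:
  "acute_isosceles {lattice_point x1 y1, lattice_point x2 y2, lattice_point x3 y3} \<longleftrightarrow>
     0 < (x2 - x1) * (x3 - x1) + (y2 - y1) * (y3 - y1) \<and>
     0 < (x1 - x2) * (x3 - x2) + (y1 - y2) * (y3 - y2) \<and>
     0 < (x1 - x3) * (x2 - x3) + (y1 - y3) * (y2 - y3) \<and>
     ((x1 - x2)\<^sup>2 + (y1 - y2)\<^sup>2 = (x1 - x3)\<^sup>2 + (y1 - y3)\<^sup>2 \<or>
      (x2 - x1)\<^sup>2 + (y2 - y1)\<^sup>2 = (x2 - x3)\<^sup>2 + (y2 - y3)\<^sup>2 \<or>
      (x3 - x1)\<^sup>2 + (y3 - y1)\<^sup>2 = (x3 - x2)\<^sup>2 + (y3 - y2)\<^sup>2)"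
  unfolding acute_isosceles_iff inner_lattice_point dist_lattice_point real_sqrt_eq_iff
    of_int_eq_iff of_int_0_less_iff ..

lemma mem_grid_iff:
  "p \<in> grid n k \<longleftrightarrow>
     (\<exists>x y. p = lattice_point x y \<and> 1 \<le> x \<and> x \<le> int n \<and> 1 \<le> y \<and> y \<le> int k)"
proof
  assume "p \<in> grid n k"
  then obtain i j where "p = lattice_point (int i) (int j)" "i \<in> {1..n}" "j \<in> {1..k}"
    by (auto simp: grid_def lattice_point_def)
  then show "\<exists>x y. p = lattice_point x y \<and> 1 \<le> x \<and> x \<le> int n \<and> 1 \<le> y \<and> y \<le> int k"
    by force
next
  assume "\<exists>x y. p = lattice_point x y \<and> 1 \<le> x \<and> x \<le> int n \<and> 1 \<le> y \<and> y \<le> int k"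
  then obtain x y where p: "p = lattice_point x y"
    and b: "1 \<le> x" "x \<le> int n" "1 \<le> y" "y \<le> int k"
    by blast
  then have "p = (real (nat x), real (nat y))" "(nat x, nat y) \<in> {1..n} \<times> {1..k}"
    by (auto simp: lattice_point_def)
  then show "p \<in> grid n k"
    unfolding grid_def by (metis (mono_tags, lifting) image_iff case_prod_conv)
qed

section \<open>Removing the first and the last row\<close>

definition acute_isosceles_in :: "(real \<times> real) set \<Rightarrow> (real \<times> real) set set" where
  "acute_isosceles_in S = {T. T \<subseteq> S \<and> acute_isosceles T}"

lemma acute_isosceles_count_eq:
  "acute_isosceles_count n k = card (acute_isosceles_in (grid n k))"
  by (simp add: acute_isosceles_count_def acute_isosceles_in_def acute_isosceles_def)

lemma finite_acute_isosceles_in: "finite S \<Longrightarrow> finite (acute_isosceles_in S)"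
  by (simp add: acute_isosceles_in_def)

lemma finite_grid: "finite (grid n k)"
  by (simp add: grid_def)

lemma acute_isosceles_translate:
  "acute_isosceles ((+) v ` T) \<longleftrightarrow> acute_isosceles T"
proof (cases "card T = 3")
  case True
  then obtain p q r where "T = {p, q, r}"
    by (auto simp: card_3_iff)
  then show ?thesis
    by (simp add: acute_isosceles_iff)
next
  case False
  then show ?thesis
    using acute_isosceles_card[of T] acute_isosceles_card[of "(+) v ` T"]
    by (auto simp: card_image)
qed

lemma card_acute_isosceles_in_translate:
  "card (acute_isosceles_in ((+) v ` S)) = card (acute_isosceles_in S)"
proof -
  have "acute_isosceles_in ((+) v ` S) = image ((+) v) ` acute_isosceles_in S"
    by (auto simp: acute_isosceles_in_def subset_image_iff acute_isosceles_translate)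
  moreover have "inj_on (image ((+) v)) (acute_isosceles_in S)"
    by (auto intro!: inj_onI simp: inj_image_eq_iff)
  ultimately show ?thesis
    by (simp add: card_image)
qed

definition spanning_triangles :: "nat \<Rightarrow> nat \<Rightarrow> (real \<times> real) set set" where
  "spanning_triangles n k =
     {T \<in> acute_isosceles_in (grid n k). 1 \<in> snd ` T \<and> real k \<in> snd ` T}"

lemma mem_shifted_grid_iff:
  "p \<in> (+) (0, 1) ` grid n k \<longleftrightarrow>
     (\<exists>x y. p = lattice_point x y \<and> 1 \<le> x \<and> x \<le> int n \<and> 2 \<le> y \<and> y \<le> int k + 1)"
proof
  assume "p \<in> (+) (0, 1) ` grid n k"
  then obtain g where "p = (0, 1) + g" "g \<in> grid n k"
    by blast
  then obtain x y where "p = (0, 1) + lattice_point x y"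
    "1 \<le> x" "x \<le> int n" "1 \<le> y" "y \<le> int k"
    unfolding mem_grid_iff by blast
  then have "p = lattice_point x (y + 1)" "1 \<le> x" "x \<le> int n" "2 \<le> y + 1" "y + 1 \<le> int k + 1"
    by (auto simp: lattice_point_def)
  then show "\<exists>x y. p = lattice_point x y \<and> 1 \<le> x \<and> x \<le> int n \<and> 2 \<le> y \<and> y \<le> int k + 1"
    by blast
next
  assume "\<exists>x y. p = lattice_point x y \<and> 1 \<le> x \<and> x \<le> int n \<and> 2 \<le> y \<and> y \<le> int k + 1"
  then obtain x y where p: "p = lattice_point x y"
    and b: "1 \<le> x" "x \<le> int n" "2 \<le> y" "y \<le> int k + 1"
    by blast
  have "p = (0, 1) + lattice_point x (y - 1)"
    by (simp add: p lattice_point_def)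
  moreover have "lattice_point x (y - 1) \<in> grid n k"
    using b by (auto simp: mem_grid_iff)
  ultimately show "p \<in> (+) (0, 1) ` grid n k"
    by blast
qed

text \<open>
  Inclusion-exclusion for the two subgrids obtained by deleting the last and the first row:
  both have one row less, their intersection has two rows less, and the triangles contained in
  neither are those touching both deleted rows.
\<close>
lemma acute_isosceles_count_second_difference:
  "acute_isosceles_count n (Suc (Suc k)) + acute_isosceles_count n k =
     2 * acute_isosceles_count n (Suc k) + card (spanning_triangles n (Suc (Suc k)))"
proof -
  let ?A = "\<lambda>S. acute_isosceles_in S"
  let ?G = "grid n (Suc (Suc k))" and ?L = "grid n (Suc k)"
  let ?U = "(+) (0, 1) ` grid n (Suc k)" and ?M = "(+) (0, 1) ` grid n k"
  let ?F = "spanning_triangles n (Suc (Suc k))"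
  have fin: "finite (?A ?L)" "finite (?A ?U)" "finite ?F"
    by (simp_all add: finite_acute_isosceles_in finite_grid spanning_triangles_def)
  have L: "p \<in> ?L \<longleftrightarrow> p \<in> ?G \<and> snd p \<noteq> real (Suc (Suc k))" for p
    by (auto simp: mem_grid_iff lattice_point_def)
  have U: "p \<in> ?U \<longleftrightarrow> p \<in> ?G \<and> snd p \<noteq> 1" for p
    by (auto simp: mem_grid_iff mem_shifted_grid_iff lattice_point_def)
  have M: "?L \<inter> ?U = ?M"
    unfolding set_eq_iff Int_iff mem_grid_iff mem_shifted_grid_iff by auto
  have avoid: "T \<subseteq> {p \<in> S. snd p \<noteq> c} \<longleftrightarrow> T \<subseteq> S \<and> c \<notin> snd ` T"
    for T S :: "(real \<times> real) set" and c
    by blast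
  have "?L = {p \<in> ?G. snd p \<noteq> real (Suc (Suc k))}" "?U = {p \<in> ?G. snd p \<noteq> 1}"
    unfolding set_eq_iff mem_Collect_eq L U by (rule allI, rule refl)+
  then have subL: "T \<subseteq> ?L \<longleftrightarrow> T \<subseteq> ?G \<and> real (Suc (Suc k)) \<notin> snd ` T"
    and subU: "T \<subseteq> ?U \<longleftrightarrow> T \<subseteq> ?G \<and> 1 \<notin> snd ` T" for T
    by (simp_all only: avoid)
  have split: "?A ?G = ?F \<union> (?A ?L \<union> ?A ?U)"
    unfolding spanning_triangles_def acute_isosceles_in_def subL subU by blast
  have "?F \<inter> (?A ?L \<union> ?A ?U) = {}"
    unfolding spanning_triangles_def acute_isosceles_in_def subL subU by blast
  then have "card (?A ?G) = card ?F + card (?A ?L \<union> ?A ?U)"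
    unfolding split using fin by (intro card_Un_disjoint) auto
  moreover have "?A ?L \<inter> ?A ?U = ?A ?M"
    unfolding acute_isosceles_in_def M[symmetric] by blast
  then have "card (?A ?L) + card (?A ?U) = card (?A ?L \<union> ?A ?U) + card (?A ?M)"
    using card_Un_Int[OF fin(1,2)] by simp
  ultimately show ?thesis
    by (simp add: acute_isosceles_count_eq card_acute_isosceles_in_translate)
qed

section \<open>Spanning triangles of tall grids\<close>

lemma int_abs_le_imp_square_le:
  "\<bar>u\<bar> \<le> (N::int) \<Longrightarrow> u\<^sup>2 \<le> N\<^sup>2"
  by (metis abs_ge_zero power2_abs power_mono)

text \<open>
  Put the third vertex at the origin, with \<open>(u, -y)\<close> the bottom vertex and \<open>(v, h - y)\<close> the top
  one. An acute angle at the origin means \<open>y * (h - y) < u * v\<close>. The left side is at least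
  \<open>h - 1\<close> and the right side at most \<open>N\<^sup>2 \<le> h\<close>, so all these bounds are attained: \<open>u = v\<close>,
  \<open>u\<^sup>2 = h\<close>, and the third vertex is one row away from an extreme row. For each pair of sides,
  equal length then becomes an equation in the integer \<open>h\<close> without an admissible solution; the
  equation \<open>h = 2\<close> is ruled out as 2 is not a square.
\<close>
lemma no_vertex_strictly_between:
  fixes u v y h N :: int
  assumes y: "0 < y" "y < h" and h: "N\<^sup>2 \<le> h"
    and uv: "\<bar>u\<bar> \<le> N" "\<bar>v\<bar> \<le> N"
    and acute: "y * (h - y) < u * v"
    and iso: "u\<^sup>2 + y\<^sup>2 = v\<^sup>2 + (h - y)\<^sup>2 \<or> u\<^sup>2 + y\<^sup>2 = (u - v)\<^sup>2 + h\<^sup>2 \<or>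
      v\<^sup>2 + (h - y)\<^sup>2 = (u - v)\<^sup>2 + h\<^sup>2"
  shows False
proof -
  have sq: "u\<^sup>2 \<le> N\<^sup>2" "v\<^sup>2 \<le> N\<^sup>2"
    using uv by (simp_all add: int_abs_le_imp_square_le)
  \<comment> \<open>A product of two positive integers with sum \<open>h\<close> is smallest when one factor is 1.\<close>
  have "0 \<le> (y - 1) * (h - y - 1)"
    using y by simp
  then have low: "h - 1 \<le> y * (h - y)"
    by (simp add: algebra_simps)
  have amgm: "2 * (u * v) = u\<^sup>2 + v\<^sup>2 - (u - v)\<^sup>2"
    by (simp add: power2_eq_square algebra_simps)
  have nn: "0 \<le> (u - v)\<^sup>2"
    by simp
  have N: "u * v = h" "N\<^sup>2 = h" "y * (h - y) = h - 1"
    using low acute amgm nn sq h by linarith+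
  then have "(u - v)\<^sup>2 = 0"
    using amgm nn sq by linarith
  then have "u = v"
    by simp
  with N have u2: "u\<^sup>2 = h" "v\<^sup>2 = h"
    by (simp_all add: power2_eq_square)
  have "(y - 1) * (h - y - 1) = 0"
    using N by (simp add: algebra_simps)
  then have ends: "y = 1 \<or> y = h - 1"
    by auto
  have not2: "h \<noteq> 2"
  proof
    assume "h = 2"
    then have "u\<^sup>2 = 2" using u2 by simp
    then have "\<bar>u\<bar> * \<bar>u\<bar> = 2" by (simp add: power2_eq_square)
    moreover have "\<bar>u\<bar> \<le> 1 \<or> 2 \<le> \<bar>u\<bar>" by linarith
    moreover have "\<bar>u\<bar> * \<bar>u\<bar> \<le> 1 * 1" if "\<bar>u\<bar> \<le> 1" using that by (intro mult_mono) auto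
    moreover have "2 * 2 \<le> \<bar>u\<bar> * \<bar>u\<bar>" if "2 \<le> \<bar>u\<bar>" using that by (intro mult_mono) auto
    ultimately show False by linarith
  qed
  with y have h3: "3 \<le> h" by linarith
  then have "3 * h \<le> h * h" by simp
  then have "1 + h \<noteq> h * h"
    using h3 by linarith
  moreover have "y + y * y \<noteq> 1" if "2 \<le> y"
    using that zero_le_square[of y] by linarith
  ultimately show False
    using ends iso h3 unfolding u2 \<open>u = v\<close>
    by (auto simp: power2_eq_square algebra_simps)
qed

text \<open>
  The base has its ends at \<open>a\<close> and \<open>c\<close>, and the apex is at abscissa \<open>m\<close> and distance \<open>h\<close> from
  the line of the base. A leg cannot equal the base: acute base angles put the apex off the
  verticals through \<open>a\<close> and \<open>c\<close>, so the squared leg exceeds \<open>h\<^sup>2 \<ge> h \<ge> N\<^sup>2\<close>, and this is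
  at least the squared base.
\<close>
lemma apex_is_centred:
  fixes a c m h N :: int
  assumes h: "N\<^sup>2 \<le> h" and base: "\<bar>a - c\<bar> \<le> N"
    and acute: "0 < (m - a) * (c - a)" "0 < (m - c) * (a - c)"
    and iso: "(m - a)\<^sup>2 + h\<^sup>2 = (m - c)\<^sup>2 + h\<^sup>2 \<or> (m - a)\<^sup>2 + h\<^sup>2 = (a - c)\<^sup>2 \<or>
      (m - c)\<^sup>2 + h\<^sup>2 = (a - c)\<^sup>2"
  shows "a + c = 2 * m"
proof -
  have "(a - c)\<^sup>2 \<le> N\<^sup>2"
    using base by (simp add: int_abs_le_imp_square_le)
  moreover have "h \<le> h\<^sup>2"
  proof (cases "1 \<le> h")
    case True
    then show ?thesis
      by (simp add: self_le_power)
  next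
    case False
    then have "h \<le> 0"
      by simp
    then show ?thesis
      using zero_le_power2[of h] by (rule order_trans)
  qed
  moreover have "0 < (m - a)\<^sup>2" "0 < (m - c)\<^sup>2"
    using acute by auto
  ultimately have "(m - a)\<^sup>2 = (m - c)\<^sup>2"
    using iso h by linarith
  then have "m - a = m - c \<or> m - a = - (m - c)"
    by (simp only: power2_eq_iff)
  moreover have "a \<noteq> c"
    using acute by auto
  ultimately show ?thesis
    by auto
qed

text \<open>
  The shapes of the spanning triangles of tall grids, squeezed into the rows 0 and 1: the base,
  with midpoint \<open>m\<close>, lies in row \<open>b\<close> and the apex in the other row. They need not be acute
  themselves.
\<close>
definition unit_spanning_triangles :: "nat \<Rightarrow> (real \<times> real) set set" where
  "unit_spanning_triangles n =
     {{lattice_point a b, lattice_point c b, lattice_point m (1 - b)} | a b c m.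
        a \<in> {1..int n} \<and> c \<in> {1..int n} \<and> m \<in> {1..int n} \<and> a \<noteq> c \<and> a + c = 2 * m \<and>
        b \<in> {0, 1}}"

definition stretch_rows :: "nat \<Rightarrow> real \<times> real \<Rightarrow> real \<times> real" where
  "stretch_rows h = (\<lambda>(x, y). (x, 1 + y * real h))"

lemma stretch_rows_lattice_point:
  "stretch_rows h (lattice_point x y) = lattice_point x (1 + y * int h)"
  by (simp add: stretch_rows_def lattice_point_def)

lemma inj_stretch_rows: "0 < h \<Longrightarrow> inj (stretch_rows h)"
  by (auto simp: inj_def stretch_rows_def)

text \<open>
  The right-hand side depends on \<open>h\<close> only through an injective map, so the number of spanning
  triangles does not depend on \<open>h\<close>.
\<close>
lemma spanning_triangles_tall:
  assumes n: "2 \<le> n" and h: "(n - 1)\<^sup>2 \<le> h"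
  shows "spanning_triangles n (Suc h) = image (stretch_rows h) ` unit_spanning_triangles n"
proof -
  define N where "N = int n - 1"
  define H where "H = int h"
  have "int ((n - 1)\<^sup>2) \<le> int h"
    using h by (simp only: of_nat_le_iff)
  then have NH: "N\<^sup>2 \<le> H"
    using n by (simp add: N_def H_def of_nat_diff)
  have N1: "1 \<le> N"
    using n by (simp add: N_def)
  then have "N \<le> N\<^sup>2"
    by (simp add: power2_eq_square)
  with NH N1 have NleH: "N \<le> H" and H1: "1 \<le> H"
    by linarith+
  have Suc: "int (Suc h) = 1 + H" "real (Suc h) = of_int (1 + H)"
    by (simp_all add: H_def)
  show ?thesis
  proof (intro equalityI subsetI)
    fix T assume "T \<in> spanning_triangles n (Suc h)"
    then have sub: "T \<subseteq> grid n (Suc h)" and T: "acute_isosceles T"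
      and rows: "1 \<in> snd ` T" "real (Suc h) \<in> snd ` T"
      by (auto simp: spanning_triangles_def acute_isosceles_in_def)
    have ex: "\<exists>x y. p = lattice_point x y \<and> x \<in> {1..int n} \<and> y \<in> {1..1 + H}"
      if "p \<in> T" for p
    proof -
      have "p \<in> grid n (Suc h)"
        using that sub by blast
      then show ?thesis
        unfolding mem_grid_iff Suc by auto
    qed
    obtain p where p: "p \<in> T" "snd p = 1"
      using rows by force
    then obtain x1 where x1: "p = lattice_point x1 1" "x1 \<in> {1..int n}"
      using ex[of p] by (auto simp: lattice_point_def)
    obtain q where q: "q \<in> T" "snd q = of_int (1 + H)"
      using rows Suc by force
    then obtain x2 where x2: "q = lattice_point x2 (1 + H)" "x2 \<in> {1..int n}"
      using ex[of q] by (auto simp: lattice_point_def simp del: of_int_add)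
    have "p \<noteq> q"
      using x1 x2 H1 by auto
    have "card (T - {p, q}) = 1"
      using p q \<open>p \<noteq> q\<close> acute_isosceles_card[OF T]
      by (subst card_Diff_subset) auto
    then obtain r where r: "T - {p, q} = {r}"
      by (auto simp: card_1_singleton_iff)
    then have T_eq: "T = {p, q, r}"
      using p q by auto
    obtain x3 y where x3: "r = lattice_point x3 (1 + y)" "x3 \<in> {1..int n}" "y \<in> {0..H}"
    proof -
      obtain x y where "r = lattice_point x y" "x \<in> {1..int n}" "y \<in> {1..1 + H}"
        using ex[of r] T_eq by auto
      then show thesis
        using that[of x "y - 1"] by auto
    qed
    note ai = T[unfolded T_eq x1(1) x2(1) x3(1) acute_isosceles_lattice_iff]
    have bd: "\<bar>x1 - x3\<bar> \<le> N" "\<bar>x2 - x3\<bar> \<le> N" "\<bar>x1 - x2\<bar> \<le> N"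
      using x1(2) x2(2) x3(2) by (auto simp: N_def)
    have "\<not> (0 < y \<and> y < H)"
    proof
      assume "0 < y \<and> y < H"
      then show False
        using NH bd ai
        by (intro no_vertex_strictly_between[of y H N "x1 - x3" "x2 - x3"])
           (auto simp: power2_eq_square algebra_simps)
    qed
    then consider "y = 0" | "y = H"
      using x3(3) by force
    then show "T \<in> image (stretch_rows h) ` unit_spanning_triangles n"
    proof cases
      case 1
      have "x1 + x3 = 2 * x2"
        using ai 1 bd
        by (intro apex_is_centred[OF NH]) (auto simp: power2_commute algebra_simps)
      moreover have "x1 \<noteq> x3"
        using ai 1 by auto
      ultimately have "{lattice_point x1 0, lattice_point x3 0, lattice_point x2 1}
          \<in> unit_spanning_triangles n"
        using x1(2) x2(2) x3(2) unfolding unit_spanning_triangles_def by force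
      moreover have "T = stretch_rows h `
          {lattice_point x1 0, lattice_point x3 0, lattice_point x2 1}"
        unfolding T_eq x1(1) x2(1) x3(1) using 1
        by (auto simp: stretch_rows_lattice_point H_def)
      ultimately show ?thesis by blast
    next
      case 2
      have "x2 + x3 = 2 * x1"
        using ai 2 bd
        by (intro apex_is_centred[OF NH]) (auto simp: power2_commute algebra_simps)
      moreover have "x2 \<noteq> x3"
        using ai 2 by auto
      ultimately have "{lattice_point x2 1, lattice_point x3 1, lattice_point x1 0}
          \<in> unit_spanning_triangles n"
        using x1(2) x2(2) x3(2) unfolding unit_spanning_triangles_def by force
      moreover have "T = stretch_rows h `
          {lattice_point x2 1, lattice_point x3 1, lattice_point x1 0}"
        unfolding T_eq x1(1) x2(1) x3(1) using 2
        by (auto simp: stretch_rows_lattice_point H_def)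
      ultimately show ?thesis by blast
    qed
  next
    fix T assume "T \<in> image (stretch_rows h) ` unit_spanning_triangles n"
    then obtain a b c m where
      T: "T = stretch_rows h ` {lattice_point a b, lattice_point c b, lattice_point m (1 - b)}"
      and r: "a \<in> {1..int n}" "c \<in> {1..int n}" "m \<in> {1..int n}"
      and ac: "a \<noteq> c" "a + c = 2 * m" and b: "b = 0 \<or> b = 1"
      unfolding unit_spanning_triangles_def by blast
    have T_eq: "T = {lattice_point a (1 + b * H), lattice_point c (1 + b * H),
        lattice_point m (1 + (1 - b) * H)}"
      by (simp add: T stretch_rows_lattice_point H_def)
    define d where "d = m - a"
    have d: "a = m - d" "c = m + d" "d \<noteq> 0"
      using ac by (auto simp: d_def)
    have "2 * \<bar>d\<bar> \<le> N"
      using r d by (auto simp: N_def)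
    with NleH H1 have "\<bar>d\<bar> < \<bar>H\<bar>" by linarith
    then have "d\<^sup>2 < H\<^sup>2"
      using power_strict_mono[of "\<bar>d\<bar>" "\<bar>H\<bar>" 2] by simp
    moreover have "0 < d\<^sup>2"
      using d by simp
    ultimately have "acute_isosceles T"
      unfolding T_eq acute_isosceles_lattice_iff d(1,2) using b
      by (auto simp: power2_eq_square algebra_simps)
    moreover have "T \<subseteq> grid n (Suc h)"
      unfolding T_eq using b r Suc H1 by (auto simp: mem_grid_iff)
    moreover have "1 \<in> snd ` T" "real (Suc h) \<in> snd ` T"
      unfolding T_eq Suc using b by (auto simp: lattice_point_def)
    ultimately show "T \<in> spanning_triangles n (Suc h)"
      by (simp add: spanning_triangles_def acute_isosceles_in_def)
  qed
qed

lemma card_spanning_triangles_tall: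
  assumes n: "2 \<le> n" and h: "(n - 1)\<^sup>2 \<le> h"
  shows "card (spanning_triangles n (Suc h)) = card (unit_spanning_triangles n)"
proof -
  have "0 < (n - 1)\<^sup>2"
    using n by simp
  with h have "0 < h"
    by linarith
  then have "inj_on (image (stretch_rows h)) (unit_spanning_triangles n)"
    using inj_stretch_rows by (metis inj_image_eq_iff inj_onI)
  then show ?thesis
    by (simp add: spanning_triangles_tall[OF n h] card_image)
qed

text \<open>
  The third difference of the counts is the difference of the numbers of spanning triangles
  with \<open>k\<close> and with \<open>k - 1\<close> rows. The smaller grid has height \<open>k - 2\<close>, and \<open>(n-1)\<^sup>2 \<le> k - 2\<close>
  is exactly the hypothesis on \<open>k\<close>.
\<close>
theorem corollary1:
  fixes n k :: nat
  assumes "n \<ge> 2"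
    and "k > (n - 1)\<^sup>2 + 1"
  shows "int (acute_isosceles_count n k) =
    3 * int (acute_isosceles_count n (k - 1))
    - 3 * int (acute_isosceles_count n (k - 2))
    + int (acute_isosceles_count n (k - 3))"
proof -
  have "0 < (n - 1)\<^sup>2"
    using assms(1) by simp
  with assms(2) have "3 \<le> k"
    by linarith
  then obtain j where k: "k = Suc (Suc (Suc j))"
    by (metis add.commute le_Suc_ex numeral_3_eq_3 add_Suc_right add_0_right)
  have "card (spanning_triangles n (Suc (Suc (Suc j)))) =
      card (spanning_triangles n (Suc (Suc j)))"
    using assms k by (simp add: card_spanning_triangles_tall)
  then show ?thesis
    using acute_isosceles_count_second_difference[of n "Suc j"]
      acute_isosceles_count_second_difference[of n j]
    by (simp add: k numeral_2_eq_2 numeral_3_eq_3)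
qed

end
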